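(* Let $G$ be a factor-critical graph. Then $\eta_{per}(G)=0$.
   Context: All graphs are finite and simple. A perfect matching of a graph is a set of edges such that every vertex is incident with exactly one edge of the set. A graph $G$ is factor-critical if $G-v$ has a perfect matching for every $v\in V(G)$. For a graph $G$ with $n$ vertices and adjacency matrix $A(G)$, the permanental polynomial is $\pi(G,x)=\mathrm{per}(xI-A(G))$, where for an $n\times n$ matrix $A=(a_{ij})$, $\mathrm{per}(A)=\sum_{\sigma}\prod_{i=1}^n a_{i\sigma(i)}$ with $\sigma$ ranging over all permutations of $\{1,\dots,n\}$. The permanental nullity $\eta_{per}(G)$ is the multiplicity of $0$ as a root of $\pi(G,x)$ (it is $0$ if $0$ is not a root).
   Formalization: The formal statement assumes that G does not have exactly one vertex: K_1 is factor-critical under the given definition (deleting its vertex leaves the null graph, with the empty perfect matching), but its permanental polynomial is x, so its permanental nullity is 1. *)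

theory Defs
  imports
    "Graph_Theory.Digraph"
    "HOL-Combinatorics.Permutations"
    "HOL-Computational_Algebra.Polynomial"
begin

text \<open>
  A finite simple graph is a finite, symmetric, loop-free digraph without parallel arcs
  (locale \<^locale>\<open>graph\<close>). An undirected edge is the two-element set of the ends of an arc,
  so the two opposite arcs between adjacent vertices give a single edge.
\<close>

definition edges :: "('a, 'b) pre_digraph \<Rightarrow> 'a set set" where
  "edges G = {{u, v} | u v. u \<rightarrow>\<^bsub>G\<^esub> v}"

definition perfect_matching :: "('a, 'b) pre_digraph \<Rightarrow> 'a set set \<Rightarrow> bool" where
  "perfect_matching G M \<longleftrightarrow> M \<subseteq> edges G \<and> (\<forall>v \<in> verts G. \<exists>!e. e \<in> M \<and> v \<in> e)"

text \<open>
  The empty set is a perfect matching of the graph without vertices, so a one-vertex graph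
  is factor-critical.
\<close>

definition factor_critical :: "('a, 'b) pre_digraph \<Rightarrow> bool" where
  "factor_critical G \<longleftrightarrow>
     (\<forall>v \<in> verts G. \<exists>M. perfect_matching (pre_digraph.del_vert G v) M)"

text \<open>
  Square matrices have their rows and columns indexed by a finite set (below, the vertex
  set itself); a permanent does not depend on a numbering of the indices.
\<close>

definition permanent :: "'i set \<Rightarrow> ('i \<Rightarrow> 'i \<Rightarrow> 'r::comm_semiring_1) \<Rightarrow> 'r" where
  "permanent I A = (\<Sum>\<sigma> | \<sigma> permutes I. \<Prod>i\<in>I. A i (\<sigma> i))"

definition adjacency_matrix :: "('a, 'b) pre_digraph \<Rightarrow> 'a \<Rightarrow> 'a \<Rightarrow> real" where
  "adjacency_matrix G u v = (if u \<rightarrow>\<^bsub>G\<^esub> v then 1 else 0)"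

definition permanental_poly :: "('a, 'b) pre_digraph \<Rightarrow> real poly" where
  "permanental_poly G =
     permanent (verts G)
       (\<lambda>u v. (if u = v then [:0, 1:] else 0) - [:adjacency_matrix G u v:])"

text \<open>
  \<^const>\<open>order\<close> is the root multiplicity, which is zero at a non-root; the permanental
  polynomial is monic, so the unspecified multiplicity for the zero polynomial never arises.
\<close>

definition permanental_nullity :: "('a, 'b) pre_digraph \<Rightarrow> nat" where
  "permanental_nullity G = order 0 (permanental_poly G)"

end

theory Submission
  imports Defs "Graph_Theory.Digraph_Component" "HOL-Combinatorics.Cycles"
begin

text \<open>
  At \<open>0\<close> the permanental polynomial takes the value \<open>per (- A) = \<plusminus> per A\<close>, and \<open>per A\<close> counts the
  permutations of the vertices that move every vertex to a neighbour. One such permutation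
  therefore shows that \<open>0\<close> is not a root (lemma \<open>permanental_nullity_eq_0\<close>).

  To find it in a factor-critical graph with an edge \<open>u v\<close>, take a perfect matching \<open>a\<close> of
  \<open>G - v\<close> and a perfect matching \<open>b\<close> of \<open>G - u\<close>. In the union of the two, the component of \<open>v\<close>
  is a path that alternates between \<open>b\<close> and \<open>a\<close> and ends at \<open>u\<close>; the edge \<open>u v\<close> closes it to
  an odd cycle. Rotate that cycle, and swap the ends of each edge of \<open>a\<close> outside it.

  Matchings are handled as involutions whose fixed points are the missed vertices. The product
  \<open>\<rho> = a \<circ> b\<close> makes two steps along the path, so only every second vertex of the
  path is needed: the set \<open>E = {v, \<rho> v, ..., u}\<close> of lemma \<open>alternating_path\<close>.
  The permutation is \<open>b\<close> on \<open>E - {u}\<close>, sends \<open>u\<close> to \<open>v\<close>, and is \<open>a\<close> elsewhere.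
  It is onto because \<open>b\<close> maps \<open>E - {u}\<close> to the same set as \<open>a\<close> maps \<open>E - {v}\<close>.
\<close>

lemma involution_of_perfect_matching:
  assumes G: "graph G" and pm: "perfect_matching (pre_digraph.del_vert G v) M"
  obtains a where "a permutes (verts G - {v})" "\<And>x. a (a x) = x"
    "\<And>x. x \<in> verts G - {v} \<Longrightarrow> x \<rightarrow>\<^bsub>G\<^esub> a x"
proof -
  interpret graph G by (rule G)
  let ?V = "verts G - {v}"
  have M_adj: "x \<rightarrow>\<^bsub>G\<^esub> y \<and> x \<in> ?V \<and> y \<in> ?V \<and> x \<noteq> y" if "{x, y} \<in> M" for x y
  proof -
    have "{x, y} \<in> edges (del_vert v)"
      using pm that unfolding perfect_matching_def by blast
    then obtain p q where pq: "{x, y} = {p, q}" "(p, q) \<in> arcs_ends (del_vert v)"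
      unfolding edges_def by blast
    then have *: "(p, q) \<in> arcs_ends G" "p \<noteq> v" "q \<noteq> v"
      by (auto simp: arcs_ends_def arc_to_ends_def del_vert_simps)
    then have "(q, p) \<in> arcs_ends G" "p \<in> verts G" "q \<in> verts G" "p \<noteq> q"
      using graph_symmetric adj_in_verts adj_not_same by auto
    with * pq(1) show ?thesis by (auto simp: doubleton_eq_iff)
  qed
  have ex1: "\<exists>!e. e \<in> M \<and> x \<in> e" if "x \<in> ?V" for x
    using pm that unfolding perfect_matching_def by (auto simp: del_vert_simps)
  have "\<exists>y. {x, y} \<in> M" if x: "x \<in> ?V" for x
  proof -
    obtain e where e: "e \<in> M" "x \<in> e" using ex1[OF x] by blast
    then have "e \<in> edges (del_vert v)" using pm unfolding perfect_matching_def by blast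
    then obtain p q where "e = {p, q}" unfolding edges_def by blast
    with e show ?thesis by (metis insert_commute insert_iff singletonD)
  qed
  then obtain f where f: "\<And>x. x \<in> ?V \<Longrightarrow> {x, f x} \<in> M" by metis
  have ff: "f (f x) = x" if x: "x \<in> ?V" for x
  proof -
    have fx: "f x \<in> ?V" "f x \<noteq> x" using M_adj[OF f[OF x]] by auto
    have "{x, f x} = {f x, f (f x)}"
      using ex1[OF fx(1)] f[OF x] f[OF fx(1)] by blast
    with fx show ?thesis by (auto simp: doubleton_eq_iff)
  qed
  define a where "a x = (if x \<in> ?V then f x else x)" for x
  have aa: "a (a x) = x" for x
    using ff M_adj[OF f] by (auto simp: a_def)
  show thesis
  proof
    show "a permutes ?V"
      unfolding permutes_def
    proof (intro conjI allI impI)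
      show "a x = x" if "x \<notin> ?V" for x using that by (simp only: a_def if_False)
      show "\<exists>!x. a x = y" for y using aa by metis
    qed
    show "a (a x) = x" for x by (rule aa)
    show "x \<rightarrow>\<^bsub>G\<^esub> a x" if "x \<in> ?V" for x
      using M_adj[OF f[OF that]] that by (simp add: a_def)
  qed
qed

text \<open>
  The involution \<open>a\<close> conjugates \<open>\<rho> = a \<circ> b\<close> to its inverse and fixes \<open>v\<close>, so it maps
  \<open>(\<rho> ^^ i) v\<close> to \<open>(\<rho> ^^ -i) v\<close>, and \<open>b = a \<circ> \<rho>\<close> maps it to \<open>(\<rho> ^^ -(i+1)) v\<close>.
  Let \<open>m\<close> be the length of the orbit of \<open>v\<close>. If \<open>m = 2 k\<close>, then \<open>a\<close> would fix a second
  point \<open>(\<rho> ^^ k) v\<close>. So \<open>m = 2 k + 1\<close>, and \<open>b\<close> fixes \<open>(\<rho> ^^ k) v\<close>, which must be \<open>u\<close>.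
  The first \<open>k + 1\<close> points of the orbit form \<open>E\<close>. The final equation says that \<open>\<rho>\<close> maps
  \<open>E - {u}\<close> onto \<open>E - {v}\<close>.
\<close>

lemma alternating_path:
  assumes fin: "finite V" and a: "a permutes V" and b: "b permutes V"
    and aa: "\<And>x. a (a x) = x" and bb: "\<And>x. b (b x) = x"
    and v: "v \<in> V" "a v = v"
    and a_fix: "\<And>x. x \<in> V \<Longrightarrow> a x = x \<Longrightarrow> x = v"
    and b_fix: "\<And>x. x \<in> V \<Longrightarrow> b x = x \<Longrightarrow> x = u"
  obtains E where "E \<subseteq> V" "v \<in> E" "u \<in> E" "b ` (E - {u}) = a ` (E - {v})"
proof -
  define \<rho> where "\<rho> = a \<circ> b"
  define p where "p i = (\<rho> ^^ i) v" for i
  have \<rho>: "\<rho> permutes V" unfolding \<rho>_def by (intro permutes_compose a b)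
  then have "bij \<rho>" by (rule permutes_bij)
  have inj: "(\<rho> ^^ i) x = (\<rho> ^^ i) y \<longleftrightarrow> x = y" for i x y
    using bij_fn[OF \<open>bij \<rho>\<close>, of i] by (auto dest: bij_is_inj injD)
  have p_add: "p (i + j) = (\<rho> ^^ i) (p j)" for i j
    by (simp add: p_def funpow_add)
  have pV: "p i \<in> V" for i
    using v(1) permutes_in_image[OF permutes_funpow[OF \<rho>]] by (simp add: p_def)
  have p_Suc: "p (Suc i) = a (b (p i))" for i by (simp add: p_def \<rho>_def)
  have b_eq: "b (p i) = a (p (Suc i))" for i by (simp add: p_Suc aa)
  have a_p: "(\<rho> ^^ i) (a (p i)) = v" for i
  proof (induction i)
    case 0
    show ?case by (simp add: p_def v)
  next
    case (Suc i)
    have "(\<rho> ^^ Suc i) (a (p (Suc i))) = (\<rho> ^^ i) (\<rho> (b (p i)))"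
      by (simp add: b_eq funpow_Suc_right del: funpow.simps)
    also have "\<rho> (b (p i)) = a (p i)" by (simp add: \<rho>_def bb)
    also note Suc
    finally show ?case .
  qed
  have "\<exists>m. m > 0 \<and> p m = v"
  proof -
    have "permutation \<rho>" using \<rho> fin by (auto simp: permutation_permutes)
    then obtain m where "\<rho> ^^ m = id" "m > 0" by (rule permutation_is_nilpotent)
    then show ?thesis by (intro exI[of _ m]) (simp add: p_def)
  qed
  then obtain m where m: "m > 0" "p m = v"
    and least: "\<And>i. i > 0 \<Longrightarrow> i < m \<Longrightarrow> p i \<noteq> v"
    using exists_least_iff[of "\<lambda>m. m > 0 \<and> p m = v"] by blast
  have "odd m"
  proof
    assume "even m"
    then obtain k where k: "m = k + k" by (metis evenE mult_2)
    have "(\<rho> ^^ k) (a (p k)) = (\<rho> ^^ k) (p k)"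
      using a_p[of k] m(2) by (simp add: k p_add)
    then have "p k = v" using a_fix[OF pV] inj by blast
    with least[of k] m(1) k show False by simp
  qed
  then obtain k where k: "m = Suc k + k" by (auto elim!: oddE simp: mult_2)
  have "(\<rho> ^^ Suc k) (a (p (Suc k))) = (\<rho> ^^ Suc k) (p k)"
    using a_p[of "Suc k"] m(2) p_add[of "Suc k" k] unfolding k by simp
  then have "b (p k) = p k" using inj b_eq by metis
  then have u: "u = p k" using b_fix[OF pV] by simp
  define E where "E = p ` {..k}"
  have neq_v: "p i \<noteq> v" if "i > 0" "i \<le> k" for i
    using least[of i] that k by simp
  have neq_u: "p i \<noteq> u" if i: "i < k" for i
  proof
    assume "p i = u"
    then have "(\<rho> ^^ i) (p (k - i)) = (\<rho> ^^ i) v"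
      using u i p_add[of i "k - i"] by (simp add: p_def)
    with inj neq_v[of "k - i"] i show False by auto
  qed
  have p0: "p 0 = v" by (simp add: p_def)
  have Eu: "E - {u} = p ` {..<k}"
    unfolding E_def using neq_u u by (auto simp: le_less)
  have Ev: "E - {v} = p ` Suc ` {..<k}"
  proof -
    have "{..k} = insert 0 (Suc ` {..<k})"
      using lessThan_Suc_eq_insert_0[of k] by (simp add: lessThan_Suc_atMost)
    moreover have "v \<noteq> p (Suc i)" if "i < k" for i
      using neq_v[of "Suc i"] that by simp
    then have "v \<notin> p ` Suc ` {..<k}" by blast
    ultimately show ?thesis unfolding E_def by (simp add: p0)
  qed
  show thesis
  proof
    show "E \<subseteq> V" unfolding E_def using pV by auto
    show "v \<in> E" unfolding E_def using p0 by force
    show "u \<in> E" unfolding E_def u by simp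
    show "b ` (E - {u}) = a ` (E - {v})"
      unfolding Eu Ev by (simp add: image_image b_eq)
  qed
qed

lemma ex_permutation_along_arcs:
  assumes G: "graph G" and fc: "factor_critical G" and uv: "u \<rightarrow>\<^bsub>G\<^esub> v"
  obtains \<sigma> where "\<sigma> permutes verts G" "\<And>x. x \<in> verts G \<Longrightarrow> x \<rightarrow>\<^bsub>G\<^esub> \<sigma> x"
proof -
  interpret graph G by (rule G)
  let ?V = "verts G"
  have V: "u \<in> ?V" "v \<in> ?V" using adj_in_verts[OF uv] by auto
  obtain M N where M: "perfect_matching (del_vert v) M" and N: "perfect_matching (del_vert u) N"
    using fc V unfolding factor_critical_def by blast
  obtain a where a: "a permutes (?V - {v})" "\<And>x. a (a x) = x"
    "\<And>x. x \<in> ?V - {v} \<Longrightarrow> x \<rightarrow>\<^bsub>G\<^esub> a x"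
    using involution_of_perfect_matching[OF G M] by blast
  obtain b where b: "b permutes (?V - {u})" "\<And>x. b (b x) = x"
    "\<And>x. x \<in> ?V - {u} \<Longrightarrow> x \<rightarrow>\<^bsub>G\<^esub> b x"
    using involution_of_perfect_matching[OF G N] by blast
  have aV: "a permutes ?V" and bV: "b permutes ?V"
    using a(1) b(1) by (auto intro: permutes_subset)
  have av: "a v = v" using permutes_not_in[OF a(1)] by simp
  have a_fix: "x = v" if "x \<in> ?V" "a x = x" for x
    using a(3)[of x] adj_not_same that by auto
  have b_fix: "x = u" if "x \<in> ?V" "b x = x" for x
    using b(3)[of x] adj_not_same that by auto
  obtain E where E: "E \<subseteq> ?V" "v \<in> E" "u \<in> E" "b ` (E - {u}) = a ` (E - {v})"
    using alternating_path[OF finite_verts aV bV a(2) b(2) V(2) av a_fix b_fix] by blast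
  define \<sigma> where "\<sigma> x = (if x = u then v else if x \<in> E then b x else a x)" for x
  have "?V = {u} \<union> (E - {u}) \<union> (?V - E)" using E(1,3) by auto
  then have "\<sigma> ` ?V = \<sigma> ` {u} \<union> \<sigma> ` (E - {u}) \<union> \<sigma> ` (?V - E)" by (metis image_Un)
  also have "\<sigma> ` {u} = {v}" by (simp add: \<sigma>_def)
  also have "\<sigma> ` (E - {u}) = b ` (E - {u})" by (intro image_cong) (auto simp: \<sigma>_def)
  also have "\<sigma> ` (?V - E) = a ` (?V - E)" using E(3) by (intro image_cong) (auto simp: \<sigma>_def)
  also have "{v} \<union> b ` (E - {u}) \<union> a ` (?V - E) = a ` ({v} \<union> (E - {v}) \<union> (?V - E))"
    unfolding image_Un E(4) by (simp add: av)
  also have "{v} \<union> (E - {v}) \<union> (?V - E) = ?V" using E by auto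
  also have "a ` ?V = ?V" by (rule permutes_image[OF aV])
  finally have surj: "\<sigma> ` ?V = ?V" .
  then have "bij_betw \<sigma> ?V ?V"
    by (simp add: bij_betw_def eq_card_imp_inj_on)
  moreover have "\<sigma> x = x" if "x \<notin> ?V" for x
    using that V E(1) permutes_not_in[OF aV] by (auto simp: \<sigma>_def)
  ultimately have "\<sigma> permutes ?V" by (intro bij_imp_permutes)
  moreover have "x \<rightarrow>\<^bsub>G\<^esub> \<sigma> x" if "x \<in> ?V" for x
    using that uv a(3)[of x] b(3)[of x] E(2) by (auto simp: \<sigma>_def)
  ultimately show thesis using that[of \<sigma>] by blast
qed

lemma poly_permanental_poly_0:
  "poly (permanental_poly G) 0
    = (- 1) ^ card (verts G) * permanent (verts G) (adjacency_matrix G)"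
proof -
  have entry: "poly ((if u = v then [:0, 1:] else 0) - [:adjacency_matrix G u v:]) 0
    = - adjacency_matrix G u v" for u v
    by simp
  have "poly (permanental_poly G) 0
      = (\<Sum>\<sigma> | \<sigma> permutes verts G. \<Prod>i\<in>verts G. - adjacency_matrix G i (\<sigma> i))"
    unfolding permanental_poly_def permanent_def poly_sum poly_prod entry ..
  also have "\<dots> = (\<Sum>\<sigma> | \<sigma> permutes verts G.
      (- 1) ^ card (verts G) * (\<Prod>i\<in>verts G. adjacency_matrix G i (\<sigma> i)))"
    unfolding prod_uminus ..
  also have "\<dots> = (- 1) ^ card (verts G) * permanent (verts G) (adjacency_matrix G)"
    unfolding permanent_def sum_distrib_left ..
  finally show ?thesis .
qed

lemma permanental_nullity_eq_0:
  assumes G: "graph G" and \<sigma>: "\<sigma> permutes verts G"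
    and adj: "\<And>x. x \<in> verts G \<Longrightarrow> x \<rightarrow>\<^bsub>G\<^esub> \<sigma> x"
  shows "permanental_nullity G = 0"
proof -
  interpret graph G by (rule G)
  have "0 < (\<Prod>i\<in>verts G. adjacency_matrix G i (\<sigma> i))"
    using adj by (simp add: adjacency_matrix_def)
  then have "0 < permanent (verts G) (adjacency_matrix G)"
    unfolding permanent_def
    by (intro sum_pos2[of _ \<sigma>] prod_nonneg)
      (auto simp: \<sigma> finite_permutations adjacency_matrix_def)
  then have "poly (permanental_poly G) 0 \<noteq> 0"
    by (simp add: poly_permanental_poly_0)
  then show ?thesis unfolding permanental_nullity_def by (rule order_0I)
qed

theorem theorem5p4:
  fixes G :: "('a, 'b) pre_digraph"
  assumes "graph G"
    and "card (verts G) \<noteq> 1"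
    and "factor_critical G"
  shows "permanental_nullity G = 0"
proof -
  interpret graph G by (rule assms)
  obtain \<sigma> where "\<sigma> permutes verts G" "\<And>x. x \<in> verts G \<Longrightarrow> x \<rightarrow>\<^bsub>G\<^esub> \<sigma> x"
  proof (cases "verts G = {}")
    case True
    \<comment> \<open>the permanent of the empty matrix is 1\<close>
    then show thesis using that[of id] by (simp add: permutes_id)
  next
    case False
    then obtain u where u: "u \<in> verts G" by blast
    with \<open>card (verts G) \<noteq> 1\<close> obtain w where w: "w \<in> verts G" "w \<noteq> u"
      by (metis is_singletonI' is_singleton_altdef empty_iff)
    \<comment> \<open>a perfect matching of \<open>G - w\<close> covers \<open>u\<close>, which therefore has a neighbour\<close>
    obtain M where "perfect_matching (del_vert w) M"
      using assms(3) w(1) unfolding factor_critical_def by blast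
    then obtain a where "\<And>x. x \<in> verts G - {w} \<Longrightarrow> x \<rightarrow>\<^bsub>G\<^esub> a x"
      using involution_of_perfect_matching[OF assms(1)] by blast
    with u w have "u \<rightarrow>\<^bsub>G\<^esub> a u" by blast
    then show thesis
      using ex_permutation_along_arcs[OF assms(1,3)] that by blast
  qed
  then show ?thesis by (rule permanental_nullity_eq_0[OF assms(1)])
qed

end
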